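(* Let $G=(V,E)$ be a finite simple undirected graph. With the notation of the context (non-induced counts $|M_a^{(5)}|$ and induced counts $|\widetilde{M}_a^{(5)}|$), the following hold: $|\widetilde{M}_{75}^{(5)}| = |M_{75}^{(5)}| - |M_{79}^{(5)}| + |M_{95}^{(5)}| - |M_{127}^{(5)}| - 2 |M_{223}^{(5)}| + |M_{235}^{(5)}| - |M_{239}^{(5)}| + 2 |M_{255}^{(5)}| + |M_{507}^{(5)}| - 3 |M_{511}^{(5)}| + 5 |M_{1023}^{(5)}|$; $|\widetilde{M}_{77}^{(5)}| = |M_{77}^{(5)}| - 2 |M_{79}^{(5)}| - 2 |M_{87}^{(5)}| - 2 |M_{94}^{(5)}| + 5 |M_{95}^{(5)}| - |M_{117}^{(5)}| + 4 |M_{119}^{(5)}| - 9 |M_{127}^{(5)}| + 6 |M_{222}^{(5)}| - 12 |M_{223}^{(5)}| + 4 |M_{235}^{(5)}| + 4 |M_{237}^{(5)}| - 10 |M_{239}^{(5)}| - 10 |M_{254}^{(5)}| + 20 |M_{255}^{(5)}| + 20 |M_{507}^{(5)}| - 36 |M_{511}^{(5)}| + 60 |M_{1023}^{(5)}|$; $|\widetilde{M}_{79}^{(5)}| = |M_{79}^{(5)}| - 2 |M_{95}^{(5)}| + 3 |M_{127}^{(5)}| + 6 |M_{223}^{(5)}| - 2 |M_{235}^{(5)}| + 3 |M_{239}^{(5)}| - 8 |M_{255}^{(5)}| - 4 |M_{507}^{(5)}| + 15 |M_{511}^{(5)}| - 30 |M_{1023}^{(5)}|$; $|\widetilde{M}_{86}^{(5)}|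 = |M_{86}^{(5)}| - |M_{87}^{(5)}| - 2 |M_{94}^{(5)}| + 2 |M_{95}^{(5)}| - 2 |M_{117}^{(5)}| + 4 |M_{119}^{(5)}| - 6 |M_{127}^{(5)}| + 6 |M_{222}^{(5)}| - 6 |M_{223}^{(5)}| + 4 |M_{235}^{(5)}| - 5 |M_{236}^{(5)}| + 7 |M_{237}^{(5)}| - 10 |M_{239}^{(5)}| - 14 |M_{254}^{(5)}| + 18 |M_{255}^{(5)}| + 24 |M_{507}^{(5)}| - 36 |M_{511}^{(5)}| + 60 |M_{1023}^{(5)}|$; $|\widetilde{M}_{87}^{(5)}| = |M_{87}^{(5)}| - 2 |M_{95}^{(5)}| - 2 |M_{119}^{(5)}| + 6 |M_{127}^{(5)}| + 6 |M_{223}^{(5)}| - |M_{237}^{(5)}| + 5 |M_{239}^{(5)}| + 4 |M_{254}^{(5)}| - 14 |M_{255}^{(5)}| - 12 |M_{507}^{(5)}| + 30 |M_{511}^{(5)}| - 60 |M_{1023}^{(5)}|$; $|\widetilde{M}_{94}^{(5)}| = |M_{94}^{(5)}| - |M_{95}^{(5)}| - |M_{119}^{(5)}| + 3 |M_{127}^{(5)}| - 6 |M_{222}^{(5)}| + 6 |M_{223}^{(5)}| - 2 |M_{237}^{(5)}| + 4 |M_{239}^{(5)}| + 8 |M_{254}^{(5)}| - 12 |M_{255}^{(5)}| - 16 |M_{507}^{(5)}| + 30 |M_{511}^{(5)}| - 60 |M_{1023}^{(5)}|$; $|\widetilde{M}_{95}^{(5)}| = |M_{95}^{(5)}| - 3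 |M_{127}^{(5)}| - 6 |M_{223}^{(5)}| - 2 |M_{239}^{(5)}| + 10 |M_{255}^{(5)}| + 4 |M_{507}^{(5)}| - 24 |M_{511}^{(5)}| + 60 |M_{1023}^{(5)}|$; $|\widetilde{M}_{117}^{(5)}| = |M_{117}^{(5)}| - 2 |M_{119}^{(5)}| + 3 |M_{127}^{(5)}| - 4 |M_{235}^{(5)}| - 2 |M_{237}^{(5)}| + 6 |M_{239}^{(5)}| + 6 |M_{254}^{(5)}| - 12 |M_{255}^{(5)}| - 16 |M_{507}^{(5)}| + 30 |M_{511}^{(5)}| - 60 |M_{1023}^{(5)}|$; $|\widetilde{M}_{119}^{(5)}| = |M_{119}^{(5)}| - 3 |M_{127}^{(5)}| - 2 |M_{239}^{(5)}| - 2 |M_{254}^{(5)}| + 8 |M_{255}^{(5)}| + 8 |M_{507}^{(5)}| - 24 |M_{511}^{(5)}| + 60 |M_{1023}^{(5)}|$; $|\widetilde{M}_{127}^{(5)}| = |M_{127}^{(5)}| - 2 |M_{255}^{(5)}| + 6 |M_{511}^{(5)}| - 20 |M_{1023}^{(5)}|$; $|\widetilde{M}_{222}^{(5)}| = |M_{222}^{(5)}| - |M_{223}^{(5)}| - |M_{254}^{(5)}| + |M_{255}^{(5)}| + 2 |M_{507}^{(5)}| - 4 |M_{511}^{(5)}| + 10 |M_{1023}^{(5)}|$; $|\widetilde{M}_{223}^{(5)}| = |M_{223}^{(5)}| - |M_{255}^{(5)}| + 3 |M_{511}^{(5)}| - 10 |M_{1023}^{(5)}|$; $|\widetilde{M}_{235}^{(5)}|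 = |M_{235}^{(5)}| - |M_{239}^{(5)}| + 2 |M_{255}^{(5)}| + 2 |M_{507}^{(5)}| - 6 |M_{511}^{(5)}| + 15 |M_{1023}^{(5)}|$; $|\widetilde{M}_{236}^{(5)}| = |M_{236}^{(5)}| - |M_{237}^{(5)}| + |M_{239}^{(5)}| + 2 |M_{254}^{(5)}| - 2 |M_{255}^{(5)}| - 4 |M_{507}^{(5)}| + 6 |M_{511}^{(5)}| - 12 |M_{1023}^{(5)}|$; $|\widetilde{M}_{237}^{(5)}| = |M_{237}^{(5)}| - 2 |M_{239}^{(5)}| - 4 |M_{254}^{(5)}| + 6 |M_{255}^{(5)}| + 12 |M_{507}^{(5)}| - 24 |M_{511}^{(5)}| + 60 |M_{1023}^{(5)}|$; $|\widetilde{M}_{239}^{(5)}| = |M_{239}^{(5)}| - 4 |M_{255}^{(5)}| - 4 |M_{507}^{(5)}| + 18 |M_{511}^{(5)}| - 60 |M_{1023}^{(5)}|$; $|\widetilde{M}_{254}^{(5)}| = |M_{254}^{(5)}| - |M_{255}^{(5)}| - 4 |M_{507}^{(5)}| + 9 |M_{511}^{(5)}| - 30 |M_{1023}^{(5)}|$; $|\widetilde{M}_{255}^{(5)}| = |M_{255}^{(5)}| - 6 |M_{511}^{(5)}| + 30 |M_{1023}^{(5)}|$; $|\widetilde{M}_{507}^{(5)}| = |M_{507}^{(5)}| - 3 |M_{511}^{(5)}| + 15 |M_{1023}^{(5)}|$; $|\widetilde{M}_{511}^{(5)}| = |M_{511}^{(5)}| - 10 |M_{1023}^{(5)}|$; $|\widetilde{M}_{1023}^{(5)}|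 = |M_{1023}^{(5)}|$.
   Context: For a fixed graph $F$ on five vertices, $|F|$ (non-induced count) is the number of subgraphs of $G$ (a vertex subset together with an edge subset) isomorphic to $F$, and $|\widetilde{F}|$ (induced count) is the number of $5$-element vertex subsets $W\subseteq V$ such that the induced subgraph $G[W]$ is isomorphic to $F$. The graphs $M_a^{(5)}$ are given by their edge sets on vertex set $\{1,\dots,5\}$: $M_{75}^{(5)}$: $\{15,25,35,45\}$; $M_{77}^{(5)}$: $\{15,25,35,34\}$; $M_{79}^{(5)}$: $\{15,25,34,35,45\}$; $M_{86}^{(5)}$: $\{15,24,34,35\}$; $M_{87}^{(5)}$: $\{15,24,34,35,45\}$; $M_{94}^{(5)}$: $\{15,24,25,34,35\}$; $M_{95}^{(5)}$: $\{15,24,25,34,35,45\}$; $M_{117}^{(5)}$: $\{15,23,24,34,45\}$; $M_{119}^{(5)}$: $\{15,23,24,34,35,45\}$; $M_{127}^{(5)}$: $\{15,23,24,25,34,35,45\}$; $M_{222}^{(5)}$: $\{14,15,24,25,34,35\}$; $M_{223}^{(5)}$: $\{14,15,24,25,34,35,45\}$; $M_{235}^{(5)}$: $\{14,15,23,25,35,45\}$; $M_{236}^{(5)}$: $\{14,15,23,25,34\}$; $M_{237}^{(5)}$: $\{14,15,23,25,34,45\}$; $M_{239}^{(5)}$: $\{14,15,23,25,34,35,45\}$; $M_{254}^{(5)}$: $\{14,15,23,24,25,34,35\}$; $M_{255}^{(5)}$: $\{14,15,23,24,25,34,35,45\}$; $M_{507}^{(5)}$: $\{13,14,15,23,24,25,35,45\}$;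 $M_{511}^{(5)}$: all pairs except $12$; $M_{1023}^{(5)}$: $K_5$. Write $|M_a^{(5)}|$ and $|\widetilde{M}_a^{(5)}|$ for the non-induced and induced counts of $M_a^{(5)}$ in $G$. *)

theory Defs
  imports Main
begin

type_synonym 'a graph = "'a set \<times> 'a set set"

abbreviation verts :: "'a graph \<Rightarrow> 'a set" where
  "verts G \<equiv> fst G"

abbreviation edges :: "'a graph \<Rightarrow> 'a set set" where
  "edges G \<equiv> snd G"

definition finite_simple_graph :: "'a graph \<Rightarrow> bool" where
  "finite_simple_graph G \<longleftrightarrow>
     finite (verts G) \<and> (\<forall>e \<in> edges G. e \<subseteq> verts G \<and> card e = 2)"

definition graph_iso :: "'a graph \<Rightarrow> 'b graph \<Rightarrow> bool" where
  "graph_iso G H \<longleftrightarrow>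
     (\<exists>f. bij_betw f (verts G) (verts H) \<and>
          (\<forall>u \<in> verts G. \<forall>v \<in> verts G. {u, v} \<in> edges G \<longleftrightarrow> {f u, f v} \<in> edges H))"

definition subgraph :: "'a graph \<Rightarrow> 'a graph \<Rightarrow> bool" where
  "subgraph H G \<longleftrightarrow>
     verts H \<subseteq> verts G \<and> edges H \<subseteq> edges G \<and> (\<forall>e \<in> edges H. e \<subseteq> verts H)"

definition induced_subgraph :: "'a graph \<Rightarrow> 'a set \<Rightarrow> 'a graph" where
  "induced_subgraph G W = (W, {e \<in> edges G. e \<subseteq> W})"

text \<open>Both counts are for patterns \<open>F\<close> on five vertices. They are integer-valued because they
  are combined with signs.\<close>

definition noninduced_count :: "'a graph \<Rightarrow> 'b graph \<Rightarrow> int" where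
  "noninduced_count G F = int (card {H. subgraph H G \<and> graph_iso H F})"

definition induced_count :: "'a graph \<Rightarrow> 'b graph \<Rightarrow> int" where
  "induced_count G F =
     int (card {W. W \<subseteq> verts G \<and> card W = 5 \<and> graph_iso (induced_subgraph G W) F})"

definition M75 :: "nat graph" where
  "M75 = ({1..5}, {{1, 5}, {2, 5}, {3, 5}, {4, 5}})"

definition M77 :: "nat graph" where
  "M77 = ({1..5}, {{1, 5}, {2, 5}, {3, 5}, {3, 4}})"

definition M79 :: "nat graph" where
  "M79 = ({1..5}, {{1, 5}, {2, 5}, {3, 4}, {3, 5}, {4, 5}})"

definition M86 :: "nat graph" where
  "M86 = ({1..5}, {{1, 5}, {2, 4}, {3, 4}, {3, 5}})"

definition M87 :: "nat graph" where
  "M87 = ({1..5}, {{1, 5}, {2, 4}, {3, 4}, {3, 5}, {4, 5}})"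

definition M94 :: "nat graph" where
  "M94 = ({1..5}, {{1, 5}, {2, 4}, {2, 5}, {3, 4}, {3, 5}})"

definition M95 :: "nat graph" where
  "M95 = ({1..5}, {{1, 5}, {2, 4}, {2, 5}, {3, 4}, {3, 5}, {4, 5}})"

definition M117 :: "nat graph" where
  "M117 = ({1..5}, {{1, 5}, {2, 3}, {2, 4}, {3, 4}, {4, 5}})"

definition M119 :: "nat graph" where
  "M119 = ({1..5}, {{1, 5}, {2, 3}, {2, 4}, {3, 4}, {3, 5}, {4, 5}})"

definition M127 :: "nat graph" where
  "M127 = ({1..5}, {{1, 5}, {2, 3}, {2, 4}, {2, 5}, {3, 4}, {3, 5}, {4, 5}})"

definition M222 :: "nat graph" where
  "M222 = ({1..5}, {{1, 4}, {1, 5}, {2, 4}, {2, 5}, {3, 4}, {3, 5}})"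

definition M223 :: "nat graph" where
  "M223 = ({1..5}, {{1, 4}, {1, 5}, {2, 4}, {2, 5}, {3, 4}, {3, 5}, {4, 5}})"

definition M235 :: "nat graph" where
  "M235 = ({1..5}, {{1, 4}, {1, 5}, {2, 3}, {2, 5}, {3, 5}, {4, 5}})"

definition M236 :: "nat graph" where
  "M236 = ({1..5}, {{1, 4}, {1, 5}, {2, 3}, {2, 5}, {3, 4}})"

definition M237 :: "nat graph" where
  "M237 = ({1..5}, {{1, 4}, {1, 5}, {2, 3}, {2, 5}, {3, 4}, {4, 5}})"

definition M239 :: "nat graph" where
  "M239 = ({1..5}, {{1, 4}, {1, 5}, {2, 3}, {2, 5}, {3, 4}, {3, 5}, {4, 5}})"

definition M254 :: "nat graph" where
  "M254 = ({1..5}, {{1, 4}, {1, 5}, {2, 3}, {2, 4}, {2, 5}, {3, 4}, {3, 5}})"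

definition M255 :: "nat graph" where
  "M255 = ({1..5}, {{1, 4}, {1, 5}, {2, 3}, {2, 4}, {2, 5}, {3, 4}, {3, 5}, {4, 5}})"

definition M507 :: "nat graph" where
  "M507 = ({1..5}, {{1, 3}, {1, 4}, {1, 5}, {2, 3}, {2, 4}, {2, 5}, {3, 5}, {4, 5}})"

definition M511 :: "nat graph" where
  "M511 = ({1..5}, {{1, 3}, {1, 4}, {1, 5}, {2, 3}, {2, 4}, {2, 5}, {3, 4}, {3, 5}, {4, 5}})"

definition M1023 :: "nat graph" where
  "M1023 = ({1..5}, {{1, 2}, {1, 3}, {1, 4}, {1, 5}, {2, 3}, {2, 4}, {2, 5}, {3, 4}, {3, 5}, {4, 5}})"

end

theory Submission
  imports Defs "HOL-Combinatorics.Multiset_Permutations"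
begin

text \<open>
  Moebius inversion over the edge sets on each five-element vertex set expresses the induced count
  of a pattern \<open>F\<close> as a sum over all five-vertex subgraphs \<open>T\<close> of \<open>G\<close>, where \<open>T\<close> is weighted by
  \<open>(-1) ^ (e(T) - e(F))\<close> times the number of copies of \<open>F\<close> in \<open>T\<close>. Up to isomorphism the 21
  patterns are closed under the insertion of an edge, hence only subgraphs isomorphic to a pattern
  contribute. So the coefficient of a pattern \<open>H\<close> is, up to sign, the number of copies of \<open>F\<close> in
  \<open>H\<close>, which is the number of embeddings of \<open>F\<close> into \<open>H\<close> divided by the number of automorphisms
  of \<open>F\<close>.
\<close>

section \<open>Finite simple graphs and their isomorphisms\<close>

lemma finite_simple_graph_edge:
  assumes "finite_simple_graph G" "e \<in> edges G"
  obtains u v where "e = {u, v}" "u \<noteq> v" "u \<in> verts G" "v \<in> verts G"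
  using assms unfolding finite_simple_graph_def card_2_iff by force

lemma finite_edges:
  assumes "finite_simple_graph G"
  shows "finite (edges G)"
  by (rule finite_subset[of _ "Pow (verts G)"]) (use assms in \<open>auto simp: finite_simple_graph_def\<close>)

lemma finite_simple_graph_subgraph:
  assumes "finite_simple_graph G" "subgraph H G"
  shows "finite_simple_graph H"
  using assms unfolding finite_simple_graph_def subgraph_def by (auto intro: finite_subset)

lemma finite_simple_graph_mono:
  assumes "finite_simple_graph (V, E)" "D \<subseteq> E"
  shows "finite_simple_graph (V, D)"
  using assms unfolding finite_simple_graph_def by auto

text \<open>Edges of a simple graph are pairs of vertices, and a vertex bijection is injective on
  sets of vertices, so preserving and reflecting adjacency amounts to mapping one edge set onto the
  other. This form is easier to restrict to subsets of the edges, to extend by an edge and to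
  compose.\<close>

lemma graph_iso_iff_image:
  assumes G: "finite_simple_graph G" and H: "finite_simple_graph H"
  shows "graph_iso G H \<longleftrightarrow> (\<exists>f. bij_betw f (verts G) (verts H) \<and> (`) f ` edges G = edges H)"
proof -
  have "(\<forall>u \<in> verts G. \<forall>v \<in> verts G. {u, v} \<in> edges G \<longleftrightarrow> {f u, f v} \<in> edges H)
      \<longleftrightarrow> (`) f ` edges G = edges H" (is "?L \<longleftrightarrow> ?R")
    if f: "bij_betw f (verts G) (verts H)" for f
  proof
    assume L: ?L
    show ?R
    proof (intro equalityI subsetI)
      fix e assume "e \<in> (`) f ` edges G"
      then obtain d where d: "d \<in> edges G" "e = f ` d" by blast
      from G d(1) show "e \<in> edges H"
        by (rule finite_simple_graph_edge) (use L d in auto)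
    next
      fix e assume e: "e \<in> edges H"
      with H obtain x y where xy: "e = {x, y}" "x \<in> verts H" "y \<in> verts H"
        by (rule finite_simple_graph_edge)
      with f obtain u v where uv: "u \<in> verts G" "v \<in> verts G" "x = f u" "y = f v"
        unfolding bij_betw_def by blast
      with L e xy have "{u, v} \<in> edges G" by auto
      moreover have "e = f ` {u, v}" using xy uv by auto
      ultimately show "e \<in> (`) f ` edges G" by blast
    qed
  next
    assume R: ?R
    have inj: "inj_on f (verts G)" using f by (simp add: bij_betw_def)
    show ?L
    proof (intro ballI iffI)
      fix u v assume "{u, v} \<in> edges G"
      then have "f ` {u, v} \<in> edges H" using R by blast
      then show "{f u, f v} \<in> edges H" by simp
    next
      fix u v assume uv: "u \<in> verts G" "v \<in> verts G" "{f u, f v} \<in> edges H"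
      then obtain d where d: "d \<in> edges G" "f ` d = f ` {u, v}"
        unfolding R[symmetric] by auto
      \<comment> \<open>A priori \<open>d\<close> only has the same image as \<open>{u, v}\<close>;
        injectivity of \<open>f\<close> on the vertices makes the two sets equal.\<close>
      have "d \<subseteq> verts G" using G d by (auto simp: finite_simple_graph_def)
      then have "d = {u, v}"
        using inj_on_image_eq_iff[OF inj, of d "{u, v}"] uv d(2) by simp
      then show "{u, v} \<in> edges G" using d by simp
    qed
  qed
  then show ?thesis unfolding graph_iso_def by blast
qed

lemma graph_iso_sym:
  assumes "graph_iso G H"
  shows "graph_iso H G"
proof -
  from assms obtain f where f: "bij_betw f (verts G) (verts H)"
    and e: "\<And>u v. u \<in> verts G \<Longrightarrow> v \<in> verts G \<Longrightarrow> {u, v} \<in> edges G \<longleftrightarrow> {f u, f v} \<in> edges H"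
    unfolding graph_iso_def by blast
  let ?g = "inv_into (verts G) f"
  have g: "bij_betw ?g (verts H) (verts G)" using f by (rule bij_betw_inv_into)
  have "{u, v} \<in> edges H \<longleftrightarrow> {?g u, ?g v} \<in> edges G" if "u \<in> verts H" "v \<in> verts H" for u v
    using e[of "?g u" "?g v"] that g f by (simp add: bij_betw_apply bij_betw_inv_into_right)
  with g show ?thesis unfolding graph_iso_def by blast
qed

lemma graph_iso_trans:
  assumes "graph_iso G H" "graph_iso H K"
  shows "graph_iso G K"
proof -
  from assms(1) obtain f where f: "bij_betw f (verts G) (verts H)"
    and fe: "\<And>u v. u \<in> verts G \<Longrightarrow> v \<in> verts G \<Longrightarrow> {u, v} \<in> edges G \<longleftrightarrow> {f u, f v} \<in> edges H"
    unfolding graph_iso_def by blast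
  from assms(2) obtain g where g: "bij_betw g (verts H) (verts K)"
    and ge: "\<And>u v. u \<in> verts H \<Longrightarrow> v \<in> verts H \<Longrightarrow> {u, v} \<in> edges H \<longleftrightarrow> {g u, g v} \<in> edges K"
    unfolding graph_iso_def by blast
  have "{u, v} \<in> edges G \<longleftrightarrow> {(g \<circ> f) u, (g \<circ> f) v} \<in> edges K"
    if "u \<in> verts G" "v \<in> verts G" for u v
    using fe[OF that] ge[of "f u" "f v"] that f by (simp add: bij_betw_apply)
  with bij_betw_trans[OF f g] show ?thesis unfolding graph_iso_def by blast
qed

lemma inj_on_image_edges:
  assumes "finite_simple_graph G" "inj_on f (verts G)"
  shows "inj_on ((`) f) (edges G)"
  by (rule inj_on_subset[OF inj_on_image_Pow[OF assms(2)]])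
     (use assms(1) in \<open>auto simp: finite_simple_graph_def\<close>)

lemma graph_iso_card_edges:
  assumes "finite_simple_graph G" "finite_simple_graph H" "graph_iso G H"
  shows "card (edges G) = card (edges H)"
proof -
  from assms(3) obtain f where f: "bij_betw f (verts G) (verts H)" "(`) f ` edges G = edges H"
    unfolding graph_iso_iff_image[OF assms(1,2)] by blast
  then show ?thesis
    using card_image[OF inj_on_image_edges[OF assms(1) bij_betw_imp_inj_on[OF f(1)]]] by simp
qed

lemma graph_iso_card_verts:
  "graph_iso G H \<Longrightarrow> card (verts G) = card (verts H)"
  unfolding graph_iso_def by (auto dest: bij_betw_same_card)

section \<open>Copies of a pattern in a graph with equally many vertices\<close>

text \<open>A copy of \<open>F\<close> uses as many vertices as \<open>T\<close> has, hence all of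
  them, and is therefore determined by its edge set.\<close>

lemma noninduced_count_spanning:
  assumes T: "finite_simple_graph T" and card: "card (verts T) = card (verts F)"
  shows "noninduced_count T F = int (card {S. S \<subseteq> edges T \<and> graph_iso (verts T, S) F})"
proof -
  have "{H. subgraph H T \<and> graph_iso H F} = Pair (verts T) ` {S. S \<subseteq> edges T \<and> graph_iso (verts T, S) F}"
  proof (intro equalityI subsetI)
    fix H assume H: "H \<in> {H. subgraph H T \<and> graph_iso H F}"
    then have "verts H \<subseteq> verts T" "card (verts H) = card (verts T)"
      using card by (auto simp: subgraph_def dest: graph_iso_card_verts)
    then have "verts H = verts T"
      using T by (intro card_subset_eq) (auto simp: finite_simple_graph_def)
    then show "H \<in> Pair (verts T) ` {S. S \<subseteq> edges T \<and> graph_iso (verts T, S) F}"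
      using H by (cases H) (auto simp: subgraph_def)
  next
    fix H assume "H \<in> Pair (verts T) ` {S. S \<subseteq> edges T \<and> graph_iso (verts T, S) F}"
    then show "H \<in> {H. subgraph H T \<and> graph_iso H F}"
      using T unfolding subgraph_def finite_simple_graph_def by fastforce
  qed
  then show ?thesis
    unfolding noninduced_count_def by (simp add: card_image inj_on_def)
qed

text \<open>Taking images of edge sets under an isomorphism carries the copies in \<open>T\<close>
  bijectively to the copies in \<open>U\<close>. Thus the weight of a subgraph in the expansion
  depends only on its isomorphism class.\<close>

lemma noninduced_count_iso:
  assumes T: "finite_simple_graph T" and U: "finite_simple_graph U" and "graph_iso T U"
    and card: "card (verts T) = card (verts F)"
  shows "noninduced_count T F = noninduced_count U F"
proof -
  from assms(3) obtain f
    where f: "bij_betw f (verts T) (verts U)" and fe: "(`) f ` edges T = edges U"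
    unfolding graph_iso_iff_image[OF T U] by blast
  have inj: "inj_on ((`) f) (edges T)"
    using inj_on_image_edges[OF T bij_betw_imp_inj_on[OF f]] .
  have iso: "graph_iso (verts T, S) (verts U, (`) f ` S)" if "S \<subseteq> edges T" for S
  proof -
    have "finite_simple_graph (verts T, S)" "finite_simple_graph (verts U, (`) f ` S)"
      using T U finite_simple_graph_mono[of "verts T" "edges T" S]
        finite_simple_graph_mono[of "verts U" "edges U" "(`) f ` S"] that fe by auto
    then show ?thesis using f by (auto simp: graph_iso_iff_image)
  qed
  have "bij_betw ((`) ((`) f)) {S. S \<subseteq> edges T \<and> graph_iso (verts T, S) F}
      {S. S \<subseteq> edges U \<and> graph_iso (verts U, S) F}"
  proof (rule bij_betw_imageI)
    show "inj_on ((`) ((`) f)) {S. S \<subseteq> edges T \<and> graph_iso (verts T, S) F}"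
      by (rule inj_on_subset[OF inj_on_image_Pow[OF inj]]) auto
    have "S \<in> (`) ((`) f) ` {S. S \<subseteq> edges T \<and> graph_iso (verts T, S) F}"
      if S: "S \<subseteq> edges U" "graph_iso (verts U, S) F" for S
    proof -
      obtain R where R: "R \<subseteq> edges T" "S = (`) f ` R"
        using S(1) fe by (metis subset_imageE)
      with S have "graph_iso (verts T, R) F"
        using graph_iso_trans[OF iso] by blast
      with R show ?thesis by blast
    qed
    moreover have "(`) f ` S \<subseteq> edges U" "graph_iso (verts U, (`) f ` S) F"
      if "S \<subseteq> edges T" "graph_iso (verts T, S) F" for S
      using that fe graph_iso_trans[OF graph_iso_sym[OF iso]] by blast+
    ultimately show "(`) ((`) f) ` {S. S \<subseteq> edges T \<and> graph_iso (verts T, S) F}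
        = {S. S \<subseteq> edges U \<and> graph_iso (verts U, S) F}"
      by blast
  qed
  then have "card {S. S \<subseteq> edges T \<and> graph_iso (verts T, S) F}
      = card {S. S \<subseteq> edges U \<and> graph_iso (verts U, S) F}"
    by (rule bij_betw_same_card)
  moreover have "card (verts U) = card (verts F)"
    using card graph_iso_card_verts[OF assms(3)] by simp
  ultimately show ?thesis
    using noninduced_count_spanning[OF T card] noninduced_count_spanning[OF U, of F] by simp
qed

section \<open>Moebius inversion and grouping by isomorphism class\<close>

text \<open>On each five-element set \<open>W\<close>, whether all edges within \<open>W\<close>
  together form a copy of \<open>F\<close> is recovered from the numbers of copies inside the
  subsets of these edges. The exponent is a sum of edge numbers because it has the parity of their
  difference and avoids truncated subtraction.\<close>

lemma induced_count_mobius: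
  assumes G: "finite_simple_graph G" and F: "finite_simple_graph F" "card (verts F) = 5"
  shows "induced_count G F = (\<Sum>T | subgraph T G \<and> card (verts T) = 5.
           (-1) ^ (card (edges T) + card (edges F)) * noninduced_count T F)"
proof -
  let ?W = "{W. W \<subseteq> verts G \<and> card W = 5}"
  let ?E = "\<lambda>W. {e \<in> edges G. e \<subseteq> W}"
  have fin: "finite ?W" "\<And>W. finite (?E W)"
    using G finite_edges[OF G] by (auto simp: finite_simple_graph_def)
  have local: "of_bool (graph_iso (W, ?E W) F)
      = (\<Sum>R \<in> Pow (?E W). (-1) ^ (card R + card (edges F)) * noninduced_count (W, R) F)"
    if W: "W \<in> ?W" for W
  proof -
    let ?f = "\<lambda>S. of_bool (S \<subseteq> ?E W \<and> graph_iso (W, S) F) :: int"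
    let ?g = "\<lambda>R. \<Sum>S \<in> Pow R. (-1) ^ card S * ?f S"
    have simple: "finite_simple_graph (W, R)" if "R \<subseteq> ?E W" for R
      using that W G by (auto simp: finite_simple_graph_def intro: finite_subset)
    \<comment> \<open>Moebius inversion in the lattice of subsets of \<open>?E W\<close>. In its
      symmetric form \<open>?g\<close> carries signs as well; they give rise to the factor
      \<open>(-1) ^ card (edges F)\<close>.\<close>
    have "?f (?E W) = (\<Sum>R \<in> Pow (?E W). (-1) ^ card R * ?g R)"
      by (rule inclusion_exclusion_symmetric) (use fin in auto)
    also have "\<dots> = (\<Sum>R \<in> Pow (?E W). (-1) ^ (card R + card (edges F)) * noninduced_count (W, R) F)"
    proof (rule sum.cong[OF refl])
      fix R assume "R \<in> Pow (?E W)"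
      then have R: "R \<subseteq> ?E W" by simp
      then have finR: "finite R" using fin(2) finite_subset by blast
      \<comment> \<open>Only edge sets of copies of \<open>F\<close> contribute, and these all have
        \<open>card (edges F)\<close> elements, so the inner sign is constant and the sum becomes a
        count.\<close>
      have "?g R = (\<Sum>S \<in> Pow R. (-1) ^ card (edges F) * ?f S)"
      proof (rule sum.cong[OF refl])
        fix S assume "S \<in> Pow R"
        then have "card S = card (edges F)" if "graph_iso (W, S) F"
          using graph_iso_card_edges[OF simple F(1), of S] R that by auto
        then show "(-1) ^ card S * ?f S = (-1) ^ card (edges F) * ?f S" by auto
      qed
      also have "\<dots> = (-1) ^ card (edges F) * (\<Sum>S \<in> Pow R. ?f S)"
        by (simp add: sum_distrib_left)
      also have "(\<Sum>S \<in> Pow R. ?f S) = int (card {S. S \<subseteq> R \<and> graph_iso (W, S) F})"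
      proof -
        have "Pow R \<inter> {S. S \<subseteq> ?E W \<and> graph_iso (W, S) F} = {S. S \<subseteq> R \<and> graph_iso (W, S) F}"
          using R by auto
        then show ?thesis using finR by (simp)
      qed
      also have "\<dots> = noninduced_count (W, R) F"
        using noninduced_count_spanning[OF simple[OF R], of F] W F(2) by simp
      finally show "(-1) ^ card R * ?g R
          = (-1) ^ (card R + card (edges F)) * noninduced_count (W, R) F"
        by (simp add: power_add)
    qed
    finally show ?thesis by simp
  qed
  have "induced_count G F = (\<Sum>W \<in> ?W. of_bool (graph_iso (W, ?E W) F))"
  proof -
    have "?W \<inter> {W. graph_iso (W, ?E W) F}
        = {W. W \<subseteq> verts G \<and> card W = 5 \<and> graph_iso (W, ?E W) F}" by auto
    then show ?thesis
      using fin(1) by (simp add: induced_count_def induced_subgraph_def)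
  qed
  also have "\<dots> = (\<Sum>W \<in> ?W. \<Sum>R \<in> Pow (?E W).
      (-1) ^ (card R + card (edges F)) * noninduced_count (W, R) F)"
    using local by (rule sum.cong[OF refl])
  also have "\<dots> = (\<Sum>T \<in> (SIGMA W:?W. Pow (?E W)).
      (-1) ^ (card (edges T) + card (edges F)) * noninduced_count T F)"
    using fin by (subst sum.Sigma) (auto simp: case_prod_beta)
  \<comment> \<open>A five-element vertex set with a choice of edges inside it is the same thing as
    a subgraph on five vertices.\<close>
  also have "(SIGMA W:?W. Pow (?E W)) = {T. subgraph T G \<and> card (verts T) = 5}"
    by (fastforce simp: subgraph_def)
  finally show ?thesis .
qed

lemma finite_subgraphs:
  assumes "finite_simple_graph G"
  shows "finite {T. subgraph T G}"
proof (rule finite_subset)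
  show "{T. subgraph T G} \<subseteq> Pow (verts G) \<times> Pow (edges G)"
    by (auto simp: subgraph_def)
  show "finite (Pow (verts G) \<times> Pow (edges G))"
    using assms finite_edges[OF assms] by (simp add: finite_simple_graph_def)
qed

text \<open>The sum over subgraphs is regrouped by isomorphism class, since sign and weight are
  class invariants. By \<open>non_iso\<close> each subgraph belongs to at most one representative,
  and by \<open>cover\<close> every nonzero term belongs to one.\<close>

lemma induced_count_expansion:
  fixes G :: "'a graph" and F :: "'b graph" and H :: "'i \<Rightarrow> 'c graph"
  assumes G: "finite_simple_graph G" and F: "finite_simple_graph F" "card (verts F) = 5"
    and fin: "finite I" and simple: "\<And>i. i \<in> I \<Longrightarrow> finite_simple_graph (H i) \<and> card (verts (H i)) = 5"
    and non_iso: "\<And>i j. i \<in> I \<Longrightarrow> j \<in> I \<Longrightarrow> graph_iso (H i) (H j) \<Longrightarrow> i = j"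
    and cover: "\<And>T :: 'a graph. finite_simple_graph T \<Longrightarrow> card (verts T) = 5 \<Longrightarrow>
      noninduced_count T F \<noteq> 0 \<Longrightarrow> \<exists>i \<in> I. graph_iso T (H i)"
  shows "induced_count G F = (\<Sum>i \<in> I. (-1) ^ (card (edges (H i)) + card (edges F)) *
           noninduced_count (H i) F * noninduced_count G (H i))"
proof -
  let ?T = "{T. subgraph T G \<and> card (verts T) = 5}"
  let ?c = "\<lambda>i. (-1) ^ (card (edges (H i)) + card (edges F)) * noninduced_count (H i) F"
  have finT: "finite ?T"
    by (rule finite_subset[OF _ finite_subgraphs[OF G]]) auto
  \<comment> \<open>The term of \<open>T\<close> is written as a sum of indicators over all
    representatives, so that the two summations can be exchanged later.\<close>
  have "(-1) ^ (card (edges T) + card (edges F)) * noninduced_count T F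
      = (\<Sum>i \<in> I. ?c i * of_bool (graph_iso T (H i)))" if "T \<in> ?T" for T
  proof (cases "\<exists>i \<in> I. graph_iso T (H i)")
    case True
    then obtain k where k: "k \<in> I" "graph_iso T (H k)" by blast
    have T: "finite_simple_graph T" "card (verts T) = 5"
      using that finite_simple_graph_subgraph[OF G] by auto
    have "graph_iso T (H i) \<longleftrightarrow> i = k" if "i \<in> I" for i
      using that k non_iso graph_iso_trans graph_iso_sym by blast
    then have "(\<Sum>i \<in> I. ?c i * of_bool (graph_iso T (H i))) = (\<Sum>i \<in> I. ?c i * of_bool (i = k))"
      by (intro sum.cong) auto
    also have "\<dots> = ?c k" using fin k by (simp add: of_bool_def if_distrib cong: if_cong)
    also have "\<dots> = (-1) ^ (card (edges T) + card (edges F)) * noninduced_count T F"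
      using graph_iso_card_edges[OF T(1) _ k(2)] noninduced_count_iso[OF T(1) _ k(2), of F]
        simple[OF k(1)] T(2) F(2) by simp
    finally show ?thesis by simp
  next
    case False
    with cover[of T] that finite_simple_graph_subgraph[OF G, of T]
    have "noninduced_count T F = 0" by blast
    with False show ?thesis by auto
  qed
  then have "induced_count G F = (\<Sum>T \<in> ?T. \<Sum>i \<in> I. ?c i * of_bool (graph_iso T (H i)))"
    unfolding induced_count_mobius[OF G F] by (rule sum.cong[OF refl])
  also have "\<dots> = (\<Sum>i \<in> I. ?c i * (\<Sum>T \<in> ?T. of_bool (graph_iso T (H i))))"
    by (subst sum.swap) (simp add: sum_distrib_left)
  also have "\<dots> = (\<Sum>i \<in> I. ?c i * noninduced_count G (H i))"
  proof (rule sum.cong[OF refl])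
    fix i assume i: "i \<in> I"
    \<comment> \<open>Being isomorphic to \<open>H i\<close> already forces five vertices, so the
      inner sum is exactly the number of copies of \<open>H i\<close> in \<open>G\<close>.\<close>
    have "?T \<inter> {T. graph_iso T (H i)} = {T. subgraph T G \<and> graph_iso T (H i)}"
      using simple[OF i] by (auto dest: graph_iso_card_verts)
    then have "(\<Sum>T \<in> ?T. of_bool (graph_iso T (H i))) = noninduced_count G (H i)"
      using finT by (simp add: noninduced_count_def)
    then show "?c i * (\<Sum>T \<in> ?T. of_bool (graph_iso T (H i))) = ?c i * noninduced_count G (H i)"
      by simp
  qed
  finally show ?thesis .
qed

section \<open>Families of graphs closed under the insertion of an edge\<close>

text \<open>The edges of \<open>T\<close> outside \<open>S\<close> are added one at a time. Each
  time the isomorphism carries the new edge to a missing edge of a member of \<open>\<F>\<close>,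
  and closure supplies the next member. This serves to show that a graph on five vertices containing
  a copy of a pattern is itself isomorphic to a pattern.\<close>

lemma graph_iso_supergraph:
  assumes T: "finite_simple_graph T" and S: "S \<subseteq> edges T" "graph_iso (verts T, S) H" "H \<in> \<F>"
    and simple: "\<And>H. H \<in> \<F> \<Longrightarrow> finite_simple_graph H"
    and closed: "\<And>H e. H \<in> \<F> \<Longrightarrow> e \<subseteq> verts H \<Longrightarrow> card e = 2 \<Longrightarrow> e \<notin> edges H \<Longrightarrow>
      \<exists>K \<in> \<F>. graph_iso (verts H, insert e (edges H)) K"
  shows "\<exists>K \<in> \<F>. graph_iso T K"
proof -
  have sub: "finite_simple_graph (verts T, R)" if "R \<subseteq> edges T" for R
    using that T by (auto simp: finite_simple_graph_def)
  have "D \<subseteq> edges T - S \<Longrightarrow> \<exists>K \<in> \<F>. graph_iso (verts T, D \<union> S) K" if "finite D" for D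
    using that
  proof induction
    case empty
    then show ?case using S by auto
  next
    case (insert e D)
    then obtain H where H: "H \<in> \<F>" "graph_iso (verts T, D \<union> S) H" by auto
    have "D \<union> S \<subseteq> edges T" using insert.prems S by auto
    from H(2) obtain f where f: "bij_betw f (verts T) (verts H)" "(`) f ` (D \<union> S) = edges H"
      unfolding graph_iso_iff_image[OF sub[OF \<open>D \<union> S \<subseteq> edges T\<close>] simple[OF H(1)]] by auto
    have e: "e \<in> edges T" "e \<notin> D \<union> S" "e \<subseteq> verts T" "card e = 2"
      using insert T by (auto simp: finite_simple_graph_def)
    have inj: "inj_on f (verts T)" using f by (simp add: bij_betw_def)
    have fe: "f ` e \<subseteq> verts H" "card (f ` e) = 2"
      using e f card_image[OF inj_on_subset[OF inj e(3)]] by (auto dest: bij_betw_apply)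
    \<comment> \<open>An edge is determined by its image because \<open>f\<close> is injective on
      the vertices, so a new edge has a new image.\<close>
    have "f ` e \<notin> edges H"
    proof
      assume "f ` e \<in> edges H"
      then obtain d where d: "d \<in> D \<union> S" "f ` e = f ` d" unfolding f(2)[symmetric] by blast
      then have "e = d"
        using inj_onD[OF inj_on_image_edges[OF T inj] d(2) e(1)] \<open>D \<union> S \<subseteq> edges T\<close> by blast
      with d e(2) show False by blast
    qed
    with closed[OF H(1) fe] obtain K
      where K: "K \<in> \<F>" "graph_iso (verts H, insert (f ` e) (edges H)) K" by blast
    have "graph_iso (verts T, insert e D \<union> S) (verts H, insert (f ` e) (edges H))"
    proof (subst graph_iso_iff_image)
      show "finite_simple_graph (verts T, insert e D \<union> S)"
        by (rule sub) (use e \<open>D \<union> S \<subseteq> edges T\<close> in auto)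
      show "finite_simple_graph (verts H, insert (f ` e) (edges H))"
        using simple[OF H(1)] fe by (auto simp: finite_simple_graph_def)
      show "\<exists>g. bij_betw g (verts (verts T, insert e D \<union> S))
          (verts (verts H, insert (f ` e) (edges H))) \<and>
          (`) g ` edges (verts T, insert e D \<union> S) = edges (verts H, insert (f ` e) (edges H))"
        using f by (intro exI[of _ f]) simp
    qed
    then show ?case using K graph_iso_trans by blast
  qed
  from this[of "edges T - S"] finite_edges[OF T] S(1) show ?thesis
    by (simp add: Un_absorb2)
qed

section \<open>Embeddings and automorphisms\<close>

text \<open>An isomorphism is constrained on \<open>V\<close> only, so many functions represent the
  same one. Extension by the identity outside \<open>V\<close> selects a single representative,
  which makes the maps countable and composable.\<close>

lemma bij_betw_obtain_permutes:
  assumes "bij_betw f V V"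
  obtains p where "p permutes V" "\<And>x. x \<in> V \<Longrightarrow> p x = f x"
proof
  show "restrict_id f V permutes V"
    using bij_betw_restrict_id[OF assms subset_refl] by (rule bij_imp_permutes) simp
qed simp

text \<open>Orbit-stabilizer: the embeddings with a given image form a coset of the automorphism group.\<close>

lemma noninduced_count_embeddings:
  assumes F: "finite_simple_graph (V, D)" and T: "finite_simple_graph (V, E)"
  shows "int (card {p. p permutes V \<and> (`) p ` D \<subseteq> E}) =
         noninduced_count (V, E) (V, D) * int (card {p. p permutes V \<and> (`) p ` D \<subseteq> D})"
proof -
  let ?fib = "\<lambda>S. {p. p permutes V \<and> (`) p ` D = S}"
  let ?S = "{S. S \<subseteq> E \<and> graph_iso (V, S) (V, D)}"
  have finV: "finite V" and finD: "finite D" and finE: "finite E"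
    using F T finite_edges[OF F] finite_edges[OF T] by (auto simp: finite_simple_graph_def)
  have iso: "graph_iso (V, D) (V, S) \<longleftrightarrow> ?fib S \<noteq> {}" if "S \<subseteq> E" for S
  proof -
    have S: "finite_simple_graph (V, S)"
      using finite_simple_graph_mono[OF T that] .
    have DV: "d \<subseteq> V" if "d \<in> D" for d using F that by (auto simp: finite_simple_graph_def)
    show ?thesis
    proof
      assume "graph_iso (V, D) (V, S)"
      then obtain f where f: "bij_betw f V V" "(`) f ` D = S"
        using graph_iso_iff_image[OF F S] by auto
      then obtain p where p: "p permutes V" "\<And>x. x \<in> V \<Longrightarrow> p x = f x"
        using bij_betw_obtain_permutes by blast
      have "p ` d = f ` d" if "d \<in> D" for d
        using p(2) DV[OF that] by (intro image_cong) auto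
      then have "(`) p ` D = S" using f(2) by (simp cong: image_cong)
      with p show "?fib S \<noteq> {}" by blast
    next
      assume "?fib S \<noteq> {}"
      then show "graph_iso (V, D) (V, S)"
        using graph_iso_iff_image[OF F S] permutes_imp_bij by fastforce
    qed
  qed
  \<comment> \<open>An injective map from the finite set \<open>D\<close> into itself is onto, so
    every self-embedding is an automorphism.\<close>
  have aut: "{p. p permutes V \<and> (`) p ` D \<subseteq> D} = ?fib D"
  proof -
    have "(`) p ` D = D" if p: "p permutes V" "(`) p ` D \<subseteq> D" for p
      using inj_on_image_edges[OF F, of p] permutes_inj_on[OF p(1)] card_image p(2) finD
      by (metis card_subset_eq snd_conv)
    then show ?thesis by auto
  qed
  have fib: "card (?fib S) = card (?fib D)" if "S \<in> ?S" for S
  proof -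
    from that iso[of S] obtain q where q: "q permutes V" "(`) q ` D = S"
      using graph_iso_sym by blast
    have im: "(`) (g \<circ> h) ` C = (`) g ` (`) h ` C" for g h :: "'a \<Rightarrow> 'a" and C
      by (simp add: image_comp comp_def)
    \<comment> \<open>Composition with one fixed embedding \<open>q\<close> of image
      \<open>S\<close> carries the automorphisms onto the fibre over \<open>S\<close>; composition
      with \<open>inv q\<close> reverses it.\<close>
    have "bij_betw ((\<circ>) q) (?fib D) (?fib S)"
    proof (rule bij_betw_byWitness[where f' = "(\<circ>) (inv q)"])
      show "\<forall>p \<in> ?fib D. inv q \<circ> (q \<circ> p) = p" "\<forall>p \<in> ?fib S. q \<circ> (inv q \<circ> p) = p"
        using q(1) by (auto simp: o_assoc permutes_inv_o)
      show "(\<circ>) q ` ?fib D \<subseteq> ?fib S"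
      proof (intro image_subsetI CollectI conjI)
        fix p assume "p \<in> ?fib D"
        then show "q \<circ> p permutes V" "(`) (q \<circ> p) ` D = S"
          using permutes_compose[OF _ q(1)] by (simp_all only: mem_Collect_eq im q(2))
      qed
      have "(`) (inv q) ` S = D"
        unfolding q(2)[symmetric] im[symmetric] by (simp add: permutes_inv_o[OF q(1)])
      then show "(\<circ>) (inv q) ` ?fib S \<subseteq> ?fib D"
        using permutes_compose[OF _ permutes_inv[OF q(1)]]
        by (intro image_subsetI CollectI conjI) (simp_all only: mem_Collect_eq im)
    qed
    then show ?thesis using bij_betw_same_card by force
  qed
  \<comment> \<open>Sorting the embeddings by their image splits them into one fibre for each copy
    of the pattern, all as large as the automorphism group.\<close>
  have "{p. p permutes V \<and> (`) p ` D \<subseteq> E} = (\<Union>S \<in> ?S. ?fib S)"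
  proof (intro equalityI subsetI)
    fix p assume "p \<in> {p. p permutes V \<and> (`) p ` D \<subseteq> E}"
    then have p: "p permutes V" "(`) p ` D \<subseteq> E" by simp_all
    then have "?fib ((`) p ` D) \<noteq> {}" by blast
    then have "graph_iso (V, (`) p ` D) (V, D)"
      by (rule graph_iso_sym[OF iffD2[OF iso[OF p(2)]]])
    then show "p \<in> (\<Union>S \<in> ?S. ?fib S)"
      using p by simp
  qed auto
  moreover have "card (\<Union>S \<in> ?S. ?fib S) = (\<Sum>S \<in> ?S. card (?fib S))"
    by (rule card_UN_disjoint) (use finE finite_permutations[OF finV] in auto)
  moreover have "(\<Sum>S \<in> ?S. card (?fib S)) = card ?S * card (?fib D)"
    using fib by simp
  moreover have "noninduced_count (V, E) (V, D) = int (card ?S)"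
    using noninduced_count_spanning[OF T, of "(V, D)"] by simp
  ultimately show ?thesis using aut by simp
qed

section \<open>Evaluation of embeddings between graphs on \<open>{1..5}\<close>\<close>

definition graph5 :: "(nat \<times> nat) list \<Rightarrow> nat graph" where
  "graph5 es = ({1..5}, (\<lambda>(i, j). {i, j}) ` set es)"

text \<open>The condition \<open>i < j\<close> fixes one orientation per edge, so entries correspond
  one-to-one to edges and the length of the list is the number of edges.\<close>

definition edge_list :: "(nat \<times> nat) list \<Rightarrow> bool" where
  "edge_list es \<longleftrightarrow> distinct es \<and> (\<forall>(i, j) \<in> set es. 1 \<le> i \<and> i < j \<and> j \<le> 5)"

text \<open>Rows and columns are indexed by \<open>0, \<dots>, 5\<close>; index \<open>0\<close> is a dummy, so that vertices need
  not be shifted during evaluation. The same holds for the vertex maps in \<open>embeds\<close>.\<close>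

definition adjacency :: "(nat \<times> nat) list \<Rightarrow> bool list list" where
  "adjacency es =
     map (\<lambda>u. map (\<lambda>v. List.member es (u, v) \<or> List.member es (v, u)) [0..<6]) [0..<6]"

definition embeds :: "(nat \<times> nat) list \<Rightarrow> bool list list \<Rightarrow> nat list \<Rightarrow> bool" where
  "embeds es B xs \<longleftrightarrow> list_all (\<lambda>(i, j). B ! ((0 # xs) ! i) ! ((0 # xs) ! j)) es"

text \<open>One-line notation: a list stands for the permutation that sends \<open>i\<close> to its
  \<open>i\<close>-th entry, counted from one.\<close>

definition perms5 :: "nat list list" where
  "perms5 = permutations_of_list_impl [1, 2, 3, 4, 5]"

text \<open>The permutations are an argument so that an evaluation can generate them once and share
  them among all pairs of graphs.\<close>

definition embedding_count :: "nat list list \<Rightarrow> (nat \<times> nat) list \<Rightarrow> bool list list \<Rightarrow> nat" where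
  "embedding_count ps es B = length (filter (embeds es B) ps)"

lemma verts_graph5: "verts (graph5 es) = {1..5}"
  by (simp add: graph5_def)

lemma finite_simple_graph_graph5:
  assumes "edge_list es"
  shows "finite_simple_graph (graph5 es)"
  using assms by (auto simp: finite_simple_graph_def graph5_def edge_list_def card_insert_if)

lemma card_edges_graph5:
  assumes "edge_list es"
  shows "card (edges (graph5 es)) = length es"
proof -
  have "inj_on (\<lambda>(i, j). {i, j}) (set es)"
  proof (rule inj_onI, clarify)
    fix i j k l
    assume "(i, j) \<in> set es" "(k, l) \<in> set es" "{i, j} = {k, l}"
    moreover from this have "i < j" "k < l" using assms by (auto simp: edge_list_def)
    ultimately show "i = k \<and> j = l" by (auto simp: doubleton_eq_iff)
  qed
  then show ?thesis
    using assms by (simp add: graph5_def card_image distinct_card edge_list_def)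
qed

text \<open>Both orientations are looked up in \<open>adjacency\<close> because a vertex map may
  reverse the order of the ends of an edge.\<close>

lemma nth_adjacency:
  assumes "u \<le> 5" "v \<le> 5"
  shows "adjacency es ! u ! v \<longleftrightarrow> {u, v} \<in> edges (graph5 es)"
proof -
  have "adjacency es ! u ! v \<longleftrightarrow> (u, v) \<in> set es \<or> (v, u) \<in> set es"
    using assms by (simp add: adjacency_def less_Suc_eq_le del: upt_Suc)
  also have "\<dots> \<longleftrightarrow> {u, v} \<in> edges (graph5 es)"
    by (force simp: graph5_def doubleton_eq_iff)
  finally show ?thesis .
qed

lemma nth_map_permutes:
  assumes "i \<in> {1..5}"
  shows "(0 # map p [1, 2, 3, 4, 5]) ! i = p i"
proof -
  from assms have "i = 1 \<or> i = 2 \<or> i = 3 \<or> i = 4 \<or> i = 5" by auto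
  then show ?thesis by auto
qed

lemma embeds_iff:
  assumes "edge_list es" "p permutes {1..5}"
  shows "embeds es (adjacency fs) (map p [1, 2, 3, 4, 5]) \<longleftrightarrow>
    (`) p ` edges (graph5 es) \<subseteq> edges (graph5 fs)"
proof -
  let ?xs = "0 # map p [1, 2, 3, 4, 5]"
  have "adjacency fs ! (?xs ! i) ! (?xs ! j) \<longleftrightarrow> p ` {i, j} \<in> edges (graph5 fs)"
    if "(i, j) \<in> set es" for i j
  proof -
    have ij: "i \<in> {1..5}" "j \<in> {1..5}" using that assms(1) by (auto simp: edge_list_def)
    then have "p i \<in> {1..5}" "p j \<in> {1..5}" using permutes_in_image[OF assms(2)] by blast+
    then show ?thesis
      using nth_adjacency[of "p i" "p j" fs] nth_map_permutes[OF ij(1), of p]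
        nth_map_permutes[OF ij(2), of p] by simp
  qed
  then have "embeds es (adjacency fs) (map p [1, 2, 3, 4, 5]) \<longleftrightarrow>
      (\<forall>(i, j) \<in> set es. p ` {i, j} \<in> edges (graph5 fs))"
    unfolding embeds_def list_all_iff by fast
  also have "\<dots> \<longleftrightarrow> (`) p ` edges (graph5 es) \<subseteq> edges (graph5 fs)"
    by (simp add: graph5_def image_subset_iff case_prod_beta)
  finally show ?thesis .
qed

lemma bij_betw_perms5:
  "bij_betw (\<lambda>p. map p [1, 2, 3, 4, 5]) {p. p permutes {1..5}} (set perms5)"
proof -
  let ?xs = "[1, 2, 3, 4, 5 :: nat]"
  have set_xs: "set ?xs = {1..5}" by auto
  have inj: "inj_on (\<lambda>p. map p ?xs) {p. p permutes {1..5}}"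
  proof (rule inj_onI)
    fix p q :: "nat \<Rightarrow> nat"
    assume pq: "p \<in> {p. p permutes {1..5}}" "q \<in> {p. p permutes {1..5}}" "map p ?xs = map q ?xs"
    then have "p x = q x" if "x \<in> {1..5}" for x
      using that set_xs by (metis map_eq_conv)
    then show "p = q"
      using pq(1,2) by (metis mem_Collect_eq permutes_not_in ext)
  qed
  have perms: "set perms5 = permutations_of_set {1..5}"
  proof -
    have "set perms5 = permutations_of_multiset (mset_set (set ?xs))"
      unfolding perms5_def set_permutations_of_list_impl by (subst mset_set_set) simp_all
    then show ?thesis unfolding set_xs by (subst permutations_of_set_altdef) simp_all
  qed
  \<comment> \<open>Surjectivity by counting: the inclusion suffices because both sets have
    \<open>5!\<close> elements.\<close>
  have "(\<lambda>p. map p ?xs) ` {p. p permutes {1..5}} = set perms5"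
  proof (rule card_subset_eq)
    show "(\<lambda>p. map p ?xs) ` {p. p permutes {1..5}} \<subseteq> set perms5"
    proof (rule image_subsetI)
      fix p :: "nat \<Rightarrow> nat" assume "p \<in> {p. p permutes {1..5}}"
      then have p: "p permutes {1..5}" by simp
      have "set (map p ?xs) = {1..5}"
        using permutes_image[OF p] set_xs by (metis set_map)
      moreover have "distinct (map p ?xs)"
        using permutes_inj_on[OF p, of "set ?xs"] unfolding distinct_map by simp
      ultimately show "map p ?xs \<in> set perms5"
        unfolding perms by (rule permutations_of_setI)
    qed
    show "card ((\<lambda>p. map p ?xs) ` {p. p permutes {1..5}}) = card (set perms5)"
      unfolding card_image[OF inj] perms by (simp add: card_permutations)
  qed simp
  with inj show ?thesis by (simp add: bij_betw_def)
qed

lemma embedding_count_eq_card: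
  assumes "edge_list es"
  shows "embedding_count perms5 es (adjacency fs) =
    card {p. p permutes {1..5} \<and> (`) p ` edges (graph5 es) \<subseteq> edges (graph5 fs)}"
proof -
  let ?m = "\<lambda>p :: nat \<Rightarrow> nat. map p [1, 2, 3, 4, 5]"
  let ?A = "{p. p permutes {1..5} \<and> (`) p ` edges (graph5 es) \<subseteq> edges (graph5 fs)}"
  have "?m ` ?A = {xs \<in> set perms5. embeds es (adjacency fs) xs}"
    unfolding bij_betw_imp_surj_on[OF bij_betw_perms5, symmetric]
    using embeds_iff[OF assms, of _ fs] by auto
  moreover have "inj_on ?m ?A"
    using bij_betw_imp_inj_on[OF bij_betw_perms5] by (rule inj_on_subset) auto
  ultimately have "bij_betw ?m ?A {xs \<in> set perms5. embeds es (adjacency fs) xs}"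
    unfolding bij_betw_def by simp
  then have "card ?A = card {xs \<in> set perms5. embeds es (adjacency fs) xs}"
    by (rule bij_betw_same_card)
  also have "\<dots> = length (filter (embeds es (adjacency fs)) perms5)"
    using distinct_permutations_of_list_impl[of "[1, 2, 3, 4, 5 :: nat]"]
    by (subst distinct_card[symmetric]) (simp_all add: perms5_def)
  finally show ?thesis by (simp add: embedding_count_def)
qed

text \<open>Embeddings number copies times automorphisms. The hypothesis is a product, so it can be
  evaluated without division; the factor cancels because the identity is an automorphism.\<close>

lemma noninduced_count_graph5:
  assumes "edge_list es" "edge_list fs"
    and "embedding_count perms5 es (adjacency fs) = embedding_count perms5 es (adjacency es) * n"
  shows "noninduced_count (graph5 fs) (graph5 es) = int n"
proof -
  have "int (embedding_count perms5 es (adjacency fs)) =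
      noninduced_count (graph5 fs) (graph5 es) * int (embedding_count perms5 es (adjacency es))"
    using noninduced_count_embeddings[of "{1..5}" "edges (graph5 es)" "edges (graph5 fs)"]
      assms(1,2)[THEN finite_simple_graph_graph5]
    by (simp add: embedding_count_eq_card[OF assms(1)] graph5_def)
  moreover have "embedding_count perms5 es (adjacency es) > 0"
  proof -
    let ?A = "{p. p permutes {1..5} \<and> (`) p ` edges (graph5 es) \<subseteq> edges (graph5 es)}"
    have "id \<in> ?A" using permutes_id by auto
    moreover have "finite ?A"
      by (rule finite_subset[OF _ finite_permutations[of "{1..5}"]]) auto
    ultimately show ?thesis
      unfolding embedding_count_eq_card[OF assms(1)] card_gt_0_iff by blast
  qed
  ultimately show ?thesis using assms(3) by simp
qed

section \<open>The 21 patterns and the checks by evaluation\<close>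

text \<open>The order is that of the indices of the graphs \<open>M75\<close> to
  \<open>M1023\<close>; with it the matrix \<open>copies\<close> is upper triangular.\<close>

definition patterns :: "(nat \<times> nat) list list" where
  "patterns =
  [[(1, 5), (2, 5), (3, 5), (4, 5)],
   [(1, 5), (2, 5), (3, 5), (3, 4)],
   [(1, 5), (2, 5), (3, 4), (3, 5), (4, 5)],
   [(1, 5), (2, 4), (3, 4), (3, 5)],
   [(1, 5), (2, 4), (3, 4), (3, 5), (4, 5)],
   [(1, 5), (2, 4), (2, 5), (3, 4), (3, 5)],
   [(1, 5), (2, 4), (2, 5), (3, 4), (3, 5), (4, 5)],
   [(1, 5), (2, 3), (2, 4), (3, 4), (4, 5)],
   [(1, 5), (2, 3), (2, 4), (3, 4), (3, 5), (4, 5)],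
   [(1, 5), (2, 3), (2, 4), (2, 5), (3, 4), (3, 5), (4, 5)],
   [(1, 4), (1, 5), (2, 4), (2, 5), (3, 4), (3, 5)],
   [(1, 4), (1, 5), (2, 4), (2, 5), (3, 4), (3, 5), (4, 5)],
   [(1, 4), (1, 5), (2, 3), (2, 5), (3, 5), (4, 5)],
   [(1, 4), (1, 5), (2, 3), (2, 5), (3, 4)],
   [(1, 4), (1, 5), (2, 3), (2, 5), (3, 4), (4, 5)],
   [(1, 4), (1, 5), (2, 3), (2, 5), (3, 4), (3, 5), (4, 5)],
   [(1, 4), (1, 5), (2, 3), (2, 4), (2, 5), (3, 4), (3, 5)],
   [(1, 4), (1, 5), (2, 3), (2, 4), (2, 5), (3, 4), (3, 5), (4, 5)],
   [(1, 3), (1, 4), (1, 5), (2, 3), (2, 4), (2, 5), (3, 5), (4, 5)],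
   [(1, 3), (1, 4), (1, 5), (2, 3), (2, 4), (2, 5), (3, 4), (3, 5), (4, 5)],
   [(1, 2), (1, 3), (1, 4), (1, 5), (2, 3), (2, 4), (2, 5), (3, 4), (3, 5), (4, 5)]]"

text \<open>The entry in row \<open>i\<close> and column \<open>j\<close> is the number of copies of pattern \<open>i\<close> in pattern \<open>j\<close>.\<close>

definition copies :: "nat list list" where
  "copies =
  [[1, 0, 1, 0, 0, 0, 1, 0, 0, 1, 0, 2, 1, 0, 0, 1, 0, 2, 1, 3, 5],
   [0, 1, 2, 0, 2, 2, 5, 1, 4, 9, 6, 12, 4, 0, 4, 10, 10, 20, 20, 36, 60],
   [0, 0, 1, 0, 0, 0, 2, 0, 0, 3, 0, 6, 2, 0, 0, 3, 0, 8, 4, 15, 30],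
   [0, 0, 0, 1, 1, 2, 2, 2, 4, 6, 6, 6, 4, 5, 7, 10, 14, 18, 24, 36, 60],
   [0, 0, 0, 0, 1, 0, 2, 0, 2, 6, 0, 6, 0, 0, 1, 5, 4, 14, 12, 30, 60],
   [0, 0, 0, 0, 0, 1, 1, 0, 1, 3, 6, 6, 0, 0, 2, 4, 8, 12, 16, 30, 60],
   [0, 0, 0, 0, 0, 0, 1, 0, 0, 3, 0, 6, 0, 0, 0, 2, 0, 10, 4, 24, 60],
   [0, 0, 0, 0, 0, 0, 0, 1, 2, 3, 0, 0, 4, 0, 2, 6, 6, 12, 16, 30, 60],
   [0, 0, 0, 0, 0, 0, 0, 0, 1, 3, 0, 0, 0, 0, 0, 2, 2, 8, 8, 24, 60],
   [0, 0, 0, 0, 0, 0, 0, 0, 0, 1, 0, 0, 0, 0, 0, 0, 0, 2, 0, 6, 20],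
   [0, 0, 0, 0, 0, 0, 0, 0, 0, 0, 1, 1, 0, 0, 0, 0, 1, 1, 2, 4, 10],
   [0, 0, 0, 0, 0, 0, 0, 0, 0, 0, 0, 1, 0, 0, 0, 0, 0, 1, 0, 3, 10],
   [0, 0, 0, 0, 0, 0, 0, 0, 0, 0, 0, 0, 1, 0, 0, 1, 0, 2, 2, 6, 15],
   [0, 0, 0, 0, 0, 0, 0, 0, 0, 0, 0, 0, 0, 1, 1, 1, 2, 2, 4, 6, 12],
   [0, 0, 0, 0, 0, 0, 0, 0, 0, 0, 0, 0, 0, 0, 1, 2, 4, 6, 12, 24, 60],
   [0, 0, 0, 0, 0, 0, 0, 0, 0, 0, 0, 0, 0, 0, 0, 1, 0, 4, 4, 18, 60],
   [0, 0, 0, 0, 0, 0, 0, 0, 0, 0, 0, 0, 0, 0, 0, 0, 1, 1, 4, 9, 30],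
   [0, 0, 0, 0, 0, 0, 0, 0, 0, 0, 0, 0, 0, 0, 0, 0, 0, 1, 0, 6, 30],
   [0, 0, 0, 0, 0, 0, 0, 0, 0, 0, 0, 0, 0, 0, 0, 0, 0, 0, 1, 3, 15],
   [0, 0, 0, 0, 0, 0, 0, 0, 0, 0, 0, 0, 0, 0, 0, 0, 0, 0, 0, 1, 10],
   [0, 0, 0, 0, 0, 0, 0, 0, 0, 0, 0, 0, 0, 0, 0, 0, 0, 0, 0, 0, 1]]"

lemma map_graph5_patterns:
  "map graph5 patterns =
   [M75, M77, M79, M86, M87, M94, M95, M117, M119, M127, M222, M223, M235, M236,
    M237, M239, M254, M255, M507, M511, M1023]"
  by (simp add: patterns_def graph5_def M75_def M77_def M79_def M86_def M87_def M94_def M95_def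
      M117_def M119_def M127_def M222_def M223_def M235_def M236_def M237_def M239_def M254_def
      M255_def M507_def M511_def M1023_def)

lemma length_patterns: "length patterns = 21"
  by (simp add: patterns_def)

lemma edge_list_patterns: "es \<in> set patterns \<Longrightarrow> edge_list es"
  by (auto simp: patterns_def edge_list_def)

lemma copies_check:
  "let ps = perms5; Bs = map adjacency patterns in
   list_all2 (\<lambda>es row. map (embedding_count ps es) Bs =
       map ((*) (embedding_count ps es (adjacency es))) row) patterns copies"
  by code_simp

text \<open>For each pattern and each of the ten vertex pairs not yet an edge, some pattern with
  exactly one more edge admits an embedding of the enlarged graph. Equality of the edge numbers
  turns this embedding into an isomorphism.\<close>

lemma insert_edge_check:
  "let ps = perms5; Bs = map (\<lambda>fs. (length fs, adjacency fs)) patterns in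
   list_all (\<lambda>es.
     list_all (\<lambda>e. List.member es e \<or>
         list_ex (\<lambda>(n, B). n = Suc (length es) \<and> list_ex (embeds (e # es) B) ps) Bs)
       [(1, 2), (1, 3), (1, 4), (1, 5), (2, 3), (2, 4), (2, 5), (3, 4), (3, 5), (4, 5)])
   patterns"
  by code_simp

lemma copies_diagonal: "i < 21 \<Longrightarrow> copies ! i ! i = 1"
proof -
  have "\<forall>i<21. copies ! i ! i = 1"
    unfolding copies_def by code_simp
  then show "i < 21 \<Longrightarrow> copies ! i ! i = 1" by blast
qed

text \<open>Together with the ones on the diagonal this separates the patterns: an isomorphism
  between two different patterns would force an entry 1 below the diagonal.\<close>

lemma copies_triangular: "j < i \<Longrightarrow> i < 21 \<Longrightarrow> copies ! i ! j = 0"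
proof -
  have "\<forall>i<21. \<forall>j<i. copies ! i ! j = 0"
    unfolding copies_def by code_simp
  then show "j < i \<Longrightarrow> i < 21 \<Longrightarrow> copies ! i ! j = 0" by blast
qed

lemma noninduced_count_patterns:
  assumes "i < 21" "j < 21"
  shows "noninduced_count (graph5 (patterns ! j)) (graph5 (patterns ! i)) = int (copies ! i ! j)"
proof (rule noninduced_count_graph5)
  show "edge_list (patterns ! i)" "edge_list (patterns ! j)"
    using assms by (simp_all add: edge_list_patterns length_patterns)
  let ?row = "map ((*) (embedding_count perms5 (patterns ! i) (adjacency (patterns ! i)))) (copies ! i)"
  have row: "map (embedding_count perms5 (patterns ! i)) (map adjacency patterns) = ?row"
    using copies_check assms(1) unfolding Let_def by (auto dest: list_all2_nthD simp: length_patterns)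
  \<comment> \<open>The evaluated identity is one between lists; knowing the length of the row
    allows column \<open>j\<close> to be read off.\<close>
  then have "length (copies ! i) = 21"
    using length_patterns by (metis length_map)
  with arg_cong[OF row, of "\<lambda>xs. xs ! j"] assms(2)
  show "embedding_count perms5 (patterns ! i) (adjacency (patterns ! j)) =
      embedding_count perms5 (patterns ! i) (adjacency (patterns ! i)) * copies ! i ! j"
    by (simp add: length_patterns)
qed

lemma patterns_insert_edge:
  assumes es: "es \<in> set patterns" and e: "e \<subseteq> {1..5}" "card e = 2" "e \<notin> edges (graph5 es)"
  shows "\<exists>fs \<in> set patterns. graph_iso ({1..5}, insert e (edges (graph5 es))) (graph5 fs)"
proof -
  obtain i j where ij: "e = {i, j}" "i < j" "1 \<le> i" "j \<le> 5"
  proof -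
    obtain u v where "e = {u, v}" "u \<noteq> v" using e(2) by (auto simp: card_2_iff)
    then show thesis using that[of u v] that[of v u] e(1) by (cases "u < v") auto
  qed
  have "(i, j) \<in> set [(1, 2), (1, 3), (1, 4), (1, 5), (2, 3), (2, 4), (2, 5), (3, 4), (3, 5), (4, 5)]"
  proof -
    have "i = 1 \<or> i = 2 \<or> i = 3 \<or> i = 4" "j = 2 \<or> j = 3 \<or> j = 4 \<or> j = 5" using ij by auto
    then show ?thesis using ij(2) by auto
  qed
  moreover have new: "(i, j) \<notin> set es"
    using e(3) ij(1) by (force simp: graph5_def)
  ultimately obtain fs xs where fs: "fs \<in> set patterns" "length fs = Suc (length es)"
    and xs: "xs \<in> set perms5" "embeds ((i, j) # es) (adjacency fs) xs"
    using insert_edge_check es unfolding Let_def list_all_iff list_ex_iff by fastforce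
  obtain p where p: "p permutes {1..5}" "xs = map p [1, 2, 3, 4, 5]"
    using xs(1) bij_betw_imp_surj_on[OF bij_betw_perms5] by blast
  have el: "edge_list ((i, j) # es)" "edge_list fs"
    using edge_list_patterns[OF es] edge_list_patterns[OF fs(1)] ij new by (auto simp: edge_list_def)
  let ?H = "graph5 ((i, j) # es)"
  have H: "?H = ({1..5}, insert e (edges (graph5 es)))" using ij by (simp add: graph5_def)
  note simple = el[THEN finite_simple_graph_graph5]
  \<comment> \<open>The map found by evaluation is injective on edges and ends in a set of equally
    many edges, hence is onto.\<close>
  have "(`) p ` edges ?H = edges (graph5 fs)"
  proof (rule card_subset_eq)
    show "finite (edges (graph5 fs))" using finite_edges[OF simple(2)] .
    show "(`) p ` edges ?H \<subseteq> edges (graph5 fs)"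
      using embeds_iff[OF el(1) p(1)] xs(2) p(2) by simp
    have "card ((`) p ` edges ?H) = card (edges ?H)"
      using inj_on_image_edges[OF simple(1)] permutes_inj_on[OF p(1)] by (intro card_image) blast
    then show "card ((`) p ` edges ?H) = card (edges (graph5 fs))"
      using el[THEN card_edges_graph5] fs(2) by simp
  qed
  then have "graph_iso ?H (graph5 fs)"
    using graph_iso_iff_image[OF simple] permutes_imp_bij[OF p(1)] verts_graph5 by metis
  then show ?thesis using fs(1) H by auto
qed

section \<open>The coefficients and the resulting identities\<close>

text \<open>The patterns are pairwise non-isomorphic, and closure under edge insertion puts every
  five-vertex graph containing a copy of a pattern among them up to isomorphism. Hence the grouped
  expansion applies, and its coefficients form row \<open>i\<close> of \<open>copies\<close> with
  signs.\<close>

lemma induced_count_pattern: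
  fixes G :: "'a graph"
  assumes G: "finite_simple_graph G" and i: "i < 21"
  shows "induced_count G (map graph5 patterns ! i) = (\<Sum>j<21.
    (-1) ^ (length (patterns ! j) + length (patterns ! i)) * int (copies ! i ! j)
      * noninduced_count G (map graph5 patterns ! j))"
proof -
  let ?H = "\<lambda>i. graph5 (patterns ! i)"
  have el: "edge_list (patterns ! j)" if "j < 21" for j
    using that by (simp add: edge_list_patterns length_patterns)
  have simple: "finite_simple_graph (?H j)" "card (verts (?H j)) = 5" if "j < 21" for j
    using finite_simple_graph_graph5[OF el[OF that]] by (simp_all add: verts_graph5)
  have non_iso: "j = k" if "j < 21" "k < 21" "graph_iso (?H j) (?H k)" for j k
  proof -
    have self: "noninduced_count (?H l) (?H l) = 1" if "l < 21" for l
      using that by (simp add: noninduced_count_patterns copies_diagonal)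
    have eq: "noninduced_count (?H j) F = noninduced_count (?H k) F" if "card (verts F) = 5" for F :: "nat graph"
      using noninduced_count_iso[OF simple(1)[OF \<open>j < 21\<close>] simple(1)[OF \<open>k < 21\<close>] \<open>graph_iso (?H j) (?H k)\<close>]
        simple(2)[OF \<open>j < 21\<close>] that by simp
    \<comment> \<open>Each pattern contains itself once. Replacing the host by the isomorphic
      pattern gives 1 in both mirrored positions, one of which lies below the diagonal unless
      \<open>j = k\<close>.\<close>
    have "copies ! j ! k = 1" "copies ! k ! j = 1"
      using eq[of "?H j"] eq[of "?H k"] self that(1,2) simple(2) by (simp_all add: noninduced_count_patterns)
    then show ?thesis
      using copies_triangular[of j k] copies_triangular[of k j] that(1,2) by (metis linorder_neqE_nat zero_neq_one)
  qed
  have cover: "\<exists>j \<in> {..<21}. graph_iso T (?H j)"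
    if T: "finite_simple_graph T" "card (verts T) = 5" "noninduced_count T (?H i) \<noteq> 0" for T :: "'a graph"
  proof -
    have "noninduced_count T (?H i) = int (card {S. S \<subseteq> edges T \<and> graph_iso (verts T, S) (?H i)})"
      by (rule noninduced_count_spanning) (use T simple(2)[OF i] in auto)
    with T(3) have "{S. S \<subseteq> edges T \<and> graph_iso (verts T, S) (?H i)} \<noteq> {}"
      by (metis card.empty of_nat_0)
    then obtain S where S: "S \<subseteq> edges T" "graph_iso (verts T, S) (?H i)" by blast
    \<comment> \<open>Enlarging the copy \<open>S\<close> edge by edge up to \<open>T\<close> never
      leaves the family of patterns.\<close>
    have "\<exists>K \<in> graph5 ` set patterns. graph_iso T K"
    proof (rule graph_iso_supergraph[OF T(1) S])
      show "?H i \<in> graph5 ` set patterns" using i by (simp add: length_patterns)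
      show "finite_simple_graph K" if "K \<in> graph5 ` set patterns" for K
        using that edge_list_patterns finite_simple_graph_graph5 by blast
      show "\<exists>L \<in> graph5 ` set patterns. graph_iso (verts K, insert e (edges K)) L"
        if "K \<in> graph5 ` set patterns" "e \<subseteq> verts K" "card e = 2" "e \<notin> edges K" for K e
        using that patterns_insert_edge by (auto simp: verts_graph5)
    qed
    then show ?thesis by (metis image_iff in_set_conv_nth length_patterns lessThan_iff)
  qed
  have "induced_count G (?H i) = (\<Sum>j<21. (-1) ^ (card (edges (?H j)) + card (edges (?H i))) *
      noninduced_count (?H j) (?H i) * noninduced_count G (?H j))"
    by (rule induced_count_expansion[OF G simple[OF i]]) (use simple non_iso cover in auto)
  then show ?thesis
    using i by (simp add: card_edges_graph5 el noninduced_count_patterns length_patterns)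
qed

theorem theorem2:
  fixes G :: "'a graph"
  assumes "finite_simple_graph G"
  shows "(induced_count G M75 =
       noninduced_count G M75 - noninduced_count G M79 + noninduced_count G M95
       - noninduced_count G M127 - 2 * noninduced_count G M223 + noninduced_count G M235
       - noninduced_count G M239 + 2 * noninduced_count G M255 + noninduced_count G M507
       - 3 * noninduced_count G M511 + 5 * noninduced_count G M1023) \<and>
     (induced_count G M77 =
       noninduced_count G M77 - 2 * noninduced_count G M79 - 2 * noninduced_count G M87
       - 2 * noninduced_count G M94 + 5 * noninduced_count G M95 - noninduced_count G M117
       + 4 * noninduced_count G M119 - 9 * noninduced_count G M127 + 6 * noninduced_count G M222
       - 12 * noninduced_count G M223 + 4 * noninduced_count G M235 + 4 * noninduced_count G M237
       - 10 * noninduced_count G M239 - 10 * noninduced_count G M254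
       + 20 * noninduced_count G M255 + 20 * noninduced_count G M507
       - 36 * noninduced_count G M511 + 60 * noninduced_count G M1023) \<and>
     (induced_count G M79 =
       noninduced_count G M79 - 2 * noninduced_count G M95 + 3 * noninduced_count G M127
       + 6 * noninduced_count G M223 - 2 * noninduced_count G M235 + 3 * noninduced_count G M239
       - 8 * noninduced_count G M255 - 4 * noninduced_count G M507 + 15 * noninduced_count G M511
       - 30 * noninduced_count G M1023) \<and>
     (induced_count G M86 =
       noninduced_count G M86 - noninduced_count G M87 - 2 * noninduced_count G M94
       + 2 * noninduced_count G M95 - 2 * noninduced_count G M117 + 4 * noninduced_count G M119
       - 6 * noninduced_count G M127 + 6 * noninduced_count G M222 - 6 * noninduced_count G M223
       + 4 * noninduced_count G M235 - 5 * noninduced_count G M236 + 7 * noninduced_count G M237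
       - 10 * noninduced_count G M239 - 14 * noninduced_count G M254
       + 18 * noninduced_count G M255 + 24 * noninduced_count G M507
       - 36 * noninduced_count G M511 + 60 * noninduced_count G M1023) \<and>
     (induced_count G M87 =
       noninduced_count G M87 - 2 * noninduced_count G M95 - 2 * noninduced_count G M119
       + 6 * noninduced_count G M127 + 6 * noninduced_count G M223 - noninduced_count G M237
       + 5 * noninduced_count G M239 + 4 * noninduced_count G M254 - 14 * noninduced_count G M255
       - 12 * noninduced_count G M507 + 30 * noninduced_count G M511
       - 60 * noninduced_count G M1023) \<and>
     (induced_count G M94 =
       noninduced_count G M94 - noninduced_count G M95 - noninduced_count G M119
       + 3 * noninduced_count G M127 - 6 * noninduced_count G M222 + 6 * noninduced_count G M223
       - 2 * noninduced_count G M237 + 4 * noninduced_count G M239 + 8 * noninduced_count G M254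
       - 12 * noninduced_count G M255 - 16 * noninduced_count G M507
       + 30 * noninduced_count G M511 - 60 * noninduced_count G M1023) \<and>
     (induced_count G M95 =
       noninduced_count G M95 - 3 * noninduced_count G M127 - 6 * noninduced_count G M223
       - 2 * noninduced_count G M239 + 10 * noninduced_count G M255 + 4 * noninduced_count G M507
       - 24 * noninduced_count G M511 + 60 * noninduced_count G M1023) \<and>
     (induced_count G M117 =
       noninduced_count G M117 - 2 * noninduced_count G M119 + 3 * noninduced_count G M127
       - 4 * noninduced_count G M235 - 2 * noninduced_count G M237 + 6 * noninduced_count G M239
       + 6 * noninduced_count G M254 - 12 * noninduced_count G M255 - 16 * noninduced_count G M507
       + 30 * noninduced_count G M511 - 60 * noninduced_count G M1023) \<and>
     (induced_count G M119 =
       noninduced_count G M119 - 3 * noninduced_count G M127 - 2 * noninduced_count G M239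
       - 2 * noninduced_count G M254 + 8 * noninduced_count G M255 + 8 * noninduced_count G M507
       - 24 * noninduced_count G M511 + 60 * noninduced_count G M1023) \<and>
     (induced_count G M127 =
       noninduced_count G M127 - 2 * noninduced_count G M255 + 6 * noninduced_count G M511
       - 20 * noninduced_count G M1023) \<and>
     (induced_count G M222 =
       noninduced_count G M222 - noninduced_count G M223 - noninduced_count G M254
       + noninduced_count G M255 + 2 * noninduced_count G M507 - 4 * noninduced_count G M511
       + 10 * noninduced_count G M1023) \<and>
     (induced_count G M223 =
       noninduced_count G M223 - noninduced_count G M255 + 3 * noninduced_count G M511
       - 10 * noninduced_count G M1023) \<and>
     (induced_count G M235 =
       noninduced_count G M235 - noninduced_count G M239 + 2 * noninduced_count G M255
       + 2 * noninduced_count G M507 - 6 * noninduced_count G M511 + 15 * noninduced_count G M1023) \<and>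
     (induced_count G M236 =
       noninduced_count G M236 - noninduced_count G M237 + noninduced_count G M239
       + 2 * noninduced_count G M254 - 2 * noninduced_count G M255 - 4 * noninduced_count G M507
       + 6 * noninduced_count G M511 - 12 * noninduced_count G M1023) \<and>
     (induced_count G M237 =
       noninduced_count G M237 - 2 * noninduced_count G M239 - 4 * noninduced_count G M254
       + 6 * noninduced_count G M255 + 12 * noninduced_count G M507 - 24 * noninduced_count G M511
       + 60 * noninduced_count G M1023) \<and>
     (induced_count G M239 =
       noninduced_count G M239 - 4 * noninduced_count G M255 - 4 * noninduced_count G M507
       + 18 * noninduced_count G M511 - 60 * noninduced_count G M1023) \<and>
     (induced_count G M254 =
       noninduced_count G M254 - noninduced_count G M255 - 4 * noninduced_count G M507
       + 9 * noninduced_count G M511 - 30 * noninduced_count G M1023) \<and>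
     (induced_count G M255 =
       noninduced_count G M255 - 6 * noninduced_count G M511 + 30 * noninduced_count G M1023) \<and>
     (induced_count G M507 =
       noninduced_count G M507 - 3 * noninduced_count G M511 + 15 * noninduced_count G M1023) \<and>
     (induced_count G M511 =
       noninduced_count G M511 - 10 * noninduced_count G M1023) \<and>
     (induced_count G M1023 =
       noninduced_count G M1023)"
proof -
  note expansion = induced_count_pattern[OF assms, unfolded map_graph5_patterns]
  \<comment> \<open>With the range of 21 indices made explicit, each identity is a computation: zero
    entries drop out and the parities of the edge numbers give the signs. Positions in the list are
    counted from zero.\<close>
  note unfold_sum = lessThan_nat_numeral patterns_def copies_def
  show ?thesis
    apply (intro conjI)
    subgoal using expansion[of 0] by (simp add: unfold_sum)
    subgoal using expansion[of 1] by (simp add: unfold_sum)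
    subgoal using expansion[of 2] by (simp add: unfold_sum)
    subgoal using expansion[of 3] by (simp add: unfold_sum)
    subgoal using expansion[of 4] by (simp add: unfold_sum)
    subgoal using expansion[of 5] by (simp add: unfold_sum)
    subgoal using expansion[of 6] by (simp add: unfold_sum)
    subgoal using expansion[of 7] by (simp add: unfold_sum)
    subgoal using expansion[of 8] by (simp add: unfold_sum)
    subgoal using expansion[of 9] by (simp add: unfold_sum)
    subgoal using expansion[of 10] by (simp add: unfold_sum)
    subgoal using expansion[of 11] by (simp add: unfold_sum)
    subgoal using expansion[of 12] by (simp add: unfold_sum)
    subgoal using expansion[of 13] by (simp add: unfold_sum)
    subgoal using expansion[of 14] by (simp add: unfold_sum)
    subgoal using expansion[of 15] by (simp add: unfold_sum)
    subgoal using expansion[of 16] by (simp add: unfold_sum)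
    subgoal using expansion[of 17] by (simp add: unfold_sum)
    subgoal using expansion[of 18] by (simp add: unfold_sum)
    subgoal using expansion[of 19] by (simp add: unfold_sum)
    subgoal using expansion[of 20] by (simp add: unfold_sum)
    done
qed

end
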